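(* Let $\Delta$ be a finite domain and, for $w\in\mathbb R$, let $\Phi(w)=\{(\alpha_1,w),\ldots,(\alpha_n,w)\}$ be a quantified Markov Logic Network (QMLN) in which every weight is $w$. Let $\widehat\Phi$ denote the first-order sentence obtained from $\alpha_1\wedge\cdots\wedge\alpha_n$ by replacing every occurrence of $\forall^*$ by $\forall$. If $\widehat\Phi$ has a model in $\Omega(\sigma,\Delta)$, then for every $\omega\in\Omega(\sigma,\Delta)$, $$\lim_{w\to\infty}p_{\Phi(w),\Delta}(\omega)=\begin{cases}0&\text{if }\omega\not\models\widehat\Phi,\\[2pt] \dfrac{1}{|\{\omega'\in\Omega(\sigma,\Delta)\mid\omega'\models\widehat\Phi\}|}&\text{if }\omega\models\widehat\Phi.\end{cases}$$
   Context: First-order logic (FOL) is function-free with a finite set $\mathbf C$ of constants; $\sigma$ is a finite set of predicate names with arities, containing all predicate names used in the formulas. A domain $\Delta$ is a finite nonempty set with $\mathbf C\subseteq\Delta$ (each constant denotes itself). $\Omega(\sigma,\Delta)$ is the set of all $\sigma$-structures over $\Delta$, called possible worlds. A quantified sentence is $\alpha=Q_1x_1\ldots Q_nx_n\colon\varphi(x_1,\ldots,x_n)$ with $Q_i\in\{\forall,\exists,\forall^*\}$ and $\varphi$ an FOL formula with free variables precisely $x_1,\ldots,x_n$. Its statistic $Q_\omega(\alpha)$ in a world $\omega$ is defined recursively: if $\alpha$ is an FOL sentence (contains no $\forall^*$), $Q_\omega(\alpha)=1$ if $\omega\models\alpha$ and $0$ otherwise; otherwise $Q_\omega(\forall x\colon\alpha')=\min_{a\in\Delta}Q_\omega(\alpha'[x/a])$,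 $Q_\omega(\exists x\colon\alpha')=\max_{a\in\Delta}Q_\omega(\alpha'[x/a])$, $Q_\omega(\forall^* x\colon\alpha')=\frac1{|\Delta|}\sum_{a\in\Delta}Q_\omega(\alpha'[x/a])$. For a QMLN $\Phi$, i.e. a finite set of pairs (quantified sentence, weight), all of whose weights are finite, the induced distribution is $p_{\Phi,\Delta}(\omega)=\frac1Z\exp\left(\sum_{(\alpha,w)\in\Phi}w\cdot Q_\omega(\alpha)\right)$ for $\omega\in\Omega(\sigma,\Delta)$, with $Z$ the normalization constant. *)

theory Defs
  imports Complex_Main "HOL-Library.FuncSet"
begin

text \<open>Every constant denotes itself, so constants and domain elements share the type \<open>'c\<close>.
  Hence \<open>Const a\<close> is also available for a domain element \<open>a\<close> outside the constants of
  the language; such terms arise from the substitutions \<open>\<alpha>[x/a]\<close>.\<close>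

datatype ('c, 'v) tm = Var 'v | Const 'c

datatype ('p, 'c, 'v) fm =
    Truth
  | Atom 'p "('c, 'v) tm list"
  | Equal "('c, 'v) tm" "('c, 'v) tm"
  | Neg "('p, 'c, 'v) fm"
  | Conj "('p, 'c, 'v) fm" "('p, 'c, 'v) fm"
  | Disj "('p, 'c, 'v) fm" "('p, 'c, 'v) fm"
  | Impl "('p, 'c, 'v) fm" "('p, 'c, 'v) fm"
  | Forall 'v "('p, 'c, 'v) fm"
  | Exists 'v "('p, 'c, 'v) fm"

primrec fv_tm :: "('c, 'v) tm \<Rightarrow> 'v set" where
  "fv_tm (Var x) = {x}"
| "fv_tm (Const c) = {}"

primrec fv :: "('p, 'c, 'v) fm \<Rightarrow> 'v set" where
  "fv Truth = {}"
| "fv (Atom P ts) = (\<Union>t\<in>set ts. fv_tm t)"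
| "fv (Equal s t) = fv_tm s \<union> fv_tm t"
| "fv (Neg \<phi>) = fv \<phi>"
| "fv (Conj \<phi> \<psi>) = fv \<phi> \<union> fv \<psi>"
| "fv (Disj \<phi> \<psi>) = fv \<phi> \<union> fv \<psi>"
| "fv (Impl \<phi> \<psi>) = fv \<phi> \<union> fv \<psi>"
| "fv (Forall x \<phi>) = fv \<phi> - {x}"
| "fv (Exists x \<phi>) = fv \<phi> - {x}"

primrec wf_tm :: "'c set \<Rightarrow> ('c, 'v) tm \<Rightarrow> bool" where
  "wf_tm C (Var x) \<longleftrightarrow> True"
| "wf_tm C (Const c) \<longleftrightarrow> c \<in> C"

primrec wf_fm :: "'c set \<Rightarrow> 'p set \<Rightarrow> ('p \<Rightarrow> nat) \<Rightarrow> ('p, 'c, 'v) fm \<Rightarrow> bool" where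
  "wf_fm C \<sigma> ar Truth \<longleftrightarrow> True"
| "wf_fm C \<sigma> ar (Atom P ts) \<longleftrightarrow> P \<in> \<sigma> \<and> length ts = ar P \<and> (\<forall>t\<in>set ts. wf_tm C t)"
| "wf_fm C \<sigma> ar (Equal s t) \<longleftrightarrow> wf_tm C s \<and> wf_tm C t"
| "wf_fm C \<sigma> ar (Neg \<phi>) \<longleftrightarrow> wf_fm C \<sigma> ar \<phi>"
| "wf_fm C \<sigma> ar (Conj \<phi> \<psi>) \<longleftrightarrow> wf_fm C \<sigma> ar \<phi> \<and> wf_fm C \<sigma> ar \<psi>"
| "wf_fm C \<sigma> ar (Disj \<phi> \<psi>) \<longleftrightarrow> wf_fm C \<sigma> ar \<phi> \<and> wf_fm C \<sigma> ar \<psi>"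
| "wf_fm C \<sigma> ar (Impl \<phi> \<psi>) \<longleftrightarrow> wf_fm C \<sigma> ar \<phi> \<and> wf_fm C \<sigma> ar \<psi>"
| "wf_fm C \<sigma> ar (Forall x \<phi>) \<longleftrightarrow> wf_fm C \<sigma> ar \<phi>"
| "wf_fm C \<sigma> ar (Exists x \<phi>) \<longleftrightarrow> wf_fm C \<sigma> ar \<phi>"

primrec subst_tm :: "'v \<Rightarrow> 'c \<Rightarrow> ('c, 'v) tm \<Rightarrow> ('c, 'v) tm" where
  "subst_tm x a (Var y) = (if y = x then Const a else Var y)"
| "subst_tm x a (Const c) = Const c"

primrec subst :: "'v \<Rightarrow> 'c \<Rightarrow> ('p, 'c, 'v) fm \<Rightarrow> ('p, 'c, 'v) fm" where
  "subst x a Truth = Truth"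
| "subst x a (Atom P ts) = Atom P (map (subst_tm x a) ts)"
| "subst x a (Equal s t) = Equal (subst_tm x a s) (subst_tm x a t)"
| "subst x a (Neg \<phi>) = Neg (subst x a \<phi>)"
| "subst x a (Conj \<phi> \<psi>) = Conj (subst x a \<phi>) (subst x a \<psi>)"
| "subst x a (Disj \<phi> \<psi>) = Disj (subst x a \<phi>) (subst x a \<psi>)"
| "subst x a (Impl \<phi> \<psi>) = Impl (subst x a \<phi>) (subst x a \<psi>)"
| "subst x a (Forall y \<phi>) = Forall y (if y = x then \<phi> else subst x a \<phi>)"
| "subst x a (Exists y \<phi>) = Exists y (if y = x then \<phi> else subst x a \<phi>)"

text \<open>The extensional function space makes each structure a unique element of
  \<open>worlds \<sigma> ar \<Delta>\<close>, so that cardinalities and sums over it are the intended ones.\<close>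

type_synonym ('p, 'c) world = "'p \<Rightarrow> 'c list set"

definition worlds :: "'p set \<Rightarrow> ('p \<Rightarrow> nat) \<Rightarrow> 'c set \<Rightarrow> ('p, 'c) world set" where
  "worlds \<sigma> ar \<Delta> = (\<Pi>\<^sub>E P\<in>\<sigma>. Pow {as. set as \<subseteq> \<Delta> \<and> length as = ar P})"

primrec val :: "('v \<Rightarrow> 'c) \<Rightarrow> ('c, 'v) tm \<Rightarrow> 'c" where
  "val e (Var x) = e x"
| "val e (Const c) = c"

primrec sat :: "'c set \<Rightarrow> ('p, 'c) world \<Rightarrow> ('v \<Rightarrow> 'c) \<Rightarrow> ('p, 'c, 'v) fm \<Rightarrow> bool" where
  "sat \<Delta> \<omega> e Truth \<longleftrightarrow> True"
| "sat \<Delta> \<omega> e (Atom P ts) \<longleftrightarrow> map (val e) ts \<in> \<omega> P"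
| "sat \<Delta> \<omega> e (Equal s t) \<longleftrightarrow> val e s = val e t"
| "sat \<Delta> \<omega> e (Neg \<phi>) \<longleftrightarrow> \<not> sat \<Delta> \<omega> e \<phi>"
| "sat \<Delta> \<omega> e (Conj \<phi> \<psi>) \<longleftrightarrow> sat \<Delta> \<omega> e \<phi> \<and> sat \<Delta> \<omega> e \<psi>"
| "sat \<Delta> \<omega> e (Disj \<phi> \<psi>) \<longleftrightarrow> sat \<Delta> \<omega> e \<phi> \<or> sat \<Delta> \<omega> e \<psi>"
| "sat \<Delta> \<omega> e (Impl \<phi> \<psi>) \<longleftrightarrow> (sat \<Delta> \<omega> e \<phi> \<longrightarrow> sat \<Delta> \<omega> e \<psi>)"
| "sat \<Delta> \<omega> e (Forall x \<phi>) \<longleftrightarrow> (\<forall>a\<in>\<Delta>. sat \<Delta> \<omega> (e(x := a)) \<phi>)"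
| "sat \<Delta> \<omega> e (Exists x \<phi>) \<longleftrightarrow> (\<exists>a\<in>\<Delta>. sat \<Delta> \<omega> (e(x := a)) \<phi>)"

text \<open>Only used for sentences, whose truth does not depend on the assignment.\<close>

definition models :: "'c set \<Rightarrow> ('p, 'c) world \<Rightarrow> ('p, 'c, 'v) fm \<Rightarrow> bool" where
  "models \<Delta> \<omega> \<phi> \<longleftrightarrow> (\<forall>e \<in> UNIV \<rightarrow> \<Delta>. sat \<Delta> \<omega> e \<phi>)"

fun conj_list :: "('p, 'c, 'v) fm list \<Rightarrow> ('p, 'c, 'v) fm" where
  "conj_list [] = Truth"
| "conj_list [\<phi>] = \<phi>"
| "conj_list (\<phi> # \<psi> # \<phi>s) = Conj \<phi> (conj_list (\<psi> # \<phi>s))"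

text \<open>\<open>StarQ\<close> is the statistical quantifier \<open>\<forall>*\<close>. The pair
  \<open>([(Q1, x1), \<dots>, (Qn, xn)], \<phi>)\<close> represents \<open>Q1 x1 \<dots> Qn xn: \<phi>\<close>.\<close>

datatype quantifier = ForallQ | ExistsQ | StarQ

type_synonym ('p, 'c, 'v) qsent = "(quantifier \<times> 'v) list \<times> ('p, 'c, 'v) fm"

fun quantified_sentence ::
    "'c set \<Rightarrow> 'p set \<Rightarrow> ('p \<Rightarrow> nat) \<Rightarrow> ('p, 'c, 'v) qsent \<Rightarrow> bool" where
  "quantified_sentence C \<sigma> ar (qs, \<phi>) \<longleftrightarrow>
     wf_fm C \<sigma> ar \<phi> \<and> distinct (map snd qs) \<and> fv \<phi> = set (map snd qs)"

fun star_free :: "('p, 'c, 'v) qsent \<Rightarrow> bool" where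
  "star_free (qs, \<phi>) \<longleftrightarrow> StarQ \<notin> set (map fst qs)"

text \<open>The first-order formula obtained by replacing every \<open>\<forall>*\<close> by \<open>\<forall>\<close>; for a star-free
  argument this is the argument itself, as a first-order formula.\<close>

fun fol_of :: "('p, 'c, 'v) qsent \<Rightarrow> ('p, 'c, 'v) fm" where
  "fol_of ([], \<phi>) = \<phi>"
| "fol_of ((ForallQ, x) # qs, \<phi>) = Forall x (fol_of (qs, \<phi>))"
| "fol_of ((ExistsQ, x) # qs, \<phi>) = Exists x (fol_of (qs, \<phi>))"
| "fol_of ((StarQ, x) # qs, \<phi>) = Forall x (fol_of (qs, \<phi>))"

fun qsubst :: "'v \<Rightarrow> 'c \<Rightarrow> ('p, 'c, 'v) qsent \<Rightarrow> ('p, 'c, 'v) qsent" where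
  "qsubst x a (qs, \<phi>) = (qs, if x \<in> set (map snd qs) then \<phi> else subst x a \<phi>)"

function statistic :: "'c set \<Rightarrow> ('p, 'c) world \<Rightarrow> ('p, 'c, 'v) qsent \<Rightarrow> real" where
  "statistic \<Delta> \<omega> ([], \<phi>) = (if models \<Delta> \<omega> \<phi> then 1 else 0)"
| "statistic \<Delta> \<omega> ((Q, x) # qs, \<phi>) =
     (if star_free ((Q, x) # qs, \<phi>)
      then (if models \<Delta> \<omega> (fol_of ((Q, x) # qs, \<phi>)) then 1 else 0)
      else case Q of
        ForallQ \<Rightarrow> Min ((\<lambda>a. statistic \<Delta> \<omega> (qsubst x a (qs, \<phi>))) ` \<Delta>)
      | ExistsQ \<Rightarrow> Max ((\<lambda>a. statistic \<Delta> \<omega> (qsubst x a (qs, \<phi>))) ` \<Delta>)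
      | StarQ \<Rightarrow> (\<Sum>a\<in>\<Delta>. statistic \<Delta> \<omega> (qsubst x a (qs, \<phi>))) / real (card \<Delta>))"
  by pat_completeness auto
termination
  by (relation "measure (\<lambda>(\<Delta>, \<omega>, \<alpha>). length (fst \<alpha>))") auto

type_synonym ('p, 'c, 'v) qmln = "(('p, 'c, 'v) qsent \<times> real) set"

definition is_qmln ::
    "'c set \<Rightarrow> 'p set \<Rightarrow> ('p \<Rightarrow> nat) \<Rightarrow> ('p, 'c, 'v) qmln \<Rightarrow> bool" where
  "is_qmln C \<sigma> ar \<Phi> \<longleftrightarrow> finite \<Phi> \<and> (\<forall>(\<alpha>, w)\<in>\<Phi>. quantified_sentence C \<sigma> ar \<alpha>)"

definition unnormalized :: "'c set \<Rightarrow> ('p, 'c, 'v) qmln \<Rightarrow> ('p, 'c) world \<Rightarrow> real" where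
  "unnormalized \<Delta> \<Phi> \<omega> = exp (\<Sum>(\<alpha>, w)\<in>\<Phi>. w * statistic \<Delta> \<omega> \<alpha>)"

definition qmln_prob ::
    "'p set \<Rightarrow> ('p \<Rightarrow> nat) \<Rightarrow> 'c set \<Rightarrow> ('p, 'c, 'v) qmln \<Rightarrow> ('p, 'c) world \<Rightarrow> real" where
  "qmln_prob \<sigma> ar \<Delta> \<Phi> \<omega> =
     unnormalized \<Delta> \<Phi> \<omega> / (\<Sum>\<omega>'\<in>worlds \<sigma> ar \<Delta>. unnormalized \<Delta> \<Phi> \<omega>')"

definition uniform_qmln ::
    "('p, 'c, 'v) qsent list \<Rightarrow> real \<Rightarrow> ('p, 'c, 'v) qmln" where
  "uniform_qmln \<alpha>s w = (\<lambda>\<alpha>. (\<alpha>, w)) ` set \<alpha>s"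

definition fol_hat :: "('p, 'c, 'v) qsent list \<Rightarrow> ('p, 'c, 'v) fm" where
  "fol_hat \<alpha>s = conj_list (map fol_of \<alpha>s)"

end

theory Submission
  imports Defs
begin

text \<open>Every statistic is at most \<open>1\<close>, and a minimum, maximum or average of finitely many numbers
  bounded by \<open>1\<close> equals \<open>1\<close> iff all, some, or all of them do; hence a sentence has statistic \<open>1\<close>
  exactly in the models of its first-order version. The exponent of the unnormalized weight is
  \<open>w\<close> times the sum of the statistics, so the models of the conjunction are exactly the maximizers
  of that sum, and the Gibbs measures concentrate uniformly on them as \<open>w\<close> grows.\<close>

lemma val_subst_tm: "val e (subst_tm x a t) = val (e(x := a)) t"
  by (cases t) auto

text \<open>A constant is substituted, so no variable can be captured. Under a binder for
  \<open>x\<close> itself the inner update overrides the outer one, which matches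
  \<open>subst\<close> stopping there.\<close>

lemma sat_subst: "sat \<Delta> \<omega> e (subst x a \<phi>) \<longleftrightarrow> sat \<Delta> \<omega> (e(x := a)) \<phi>"
  by (induction \<phi> arbitrary: e) (auto simp: val_subst_tm fun_upd_twist comp_def)

lemma fv_tm_subst_tm: "fv_tm (subst_tm x a t) = fv_tm t - {x}"
  by (cases t) auto

lemma fv_subst: "fv (subst x a \<phi>) = fv \<phi> - {x}"
  by (induction \<phi>) (auto simp: fv_tm_subst_tm)

lemma val_cong: "(\<And>x. x \<in> fv_tm t \<Longrightarrow> e x = e' x) \<Longrightarrow> val e t = val e' t"
  by (cases t) auto

lemma sat_cong: "(\<And>x. x \<in> fv \<phi> \<Longrightarrow> e x = e' x) \<Longrightarrow> sat \<Delta> \<omega> e \<phi> \<longleftrightarrow> sat \<Delta> \<omega> e' \<phi>"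
proof (induction \<phi> arbitrary: e e')
  case (Atom P ts)
  then have "map (val e) ts = map (val e') ts"
    by (auto intro!: val_cong)
  then show ?case by (simp del: map_eq_conv)
next
  case (Equal s t)
  then show ?case using val_cong[of s e e'] val_cong[of t e e'] by simp
next
  case (Neg \<phi>)
  from Neg.IH[of e e'] Neg.prems show ?case by simp
next
  case (Conj \<phi> \<psi>)
  from Conj.IH[of e e'] Conj.prems show ?case by simp
next
  case (Disj \<phi> \<psi>)
  from Disj.IH[of e e'] Disj.prems show ?case by simp
next
  case (Impl \<phi> \<psi>)
  from Impl.IH[of e e'] Impl.prems show ?case by simp
next
  case (Forall x \<phi>)
  have "sat \<Delta> \<omega> (e(x := a)) \<phi> \<longleftrightarrow> sat \<Delta> \<omega> (e'(x := a)) \<phi>" for a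
    by (rule Forall.IH) (use Forall.prems in auto)
  then show ?case by simp
next
  case (Exists x \<phi>)
  have "sat \<Delta> \<omega> (e(x := a)) \<phi> \<longleftrightarrow> sat \<Delta> \<omega> (e'(x := a)) \<phi>" for a
    by (rule Exists.IH) (use Exists.prems in auto)
  then show ?case by simp
qed simp

text \<open>\<open>models\<close> demands truth under every assignment into \<Delta>. Reducing it to
  a single assignment \<open>e\<close> is what lets it pass through an existential
  quantifier.\<close>

lemma models_closed:
  assumes "fv \<phi> = {}" "e \<in> UNIV \<rightarrow> \<Delta>"
  shows "models \<Delta> \<omega> \<phi> \<longleftrightarrow> sat \<Delta> \<omega> e \<phi>"
proof -
  have "sat \<Delta> \<omega> e' \<phi>" if "sat \<Delta> \<omega> e \<phi>" for e'
    using that assms(1) sat_cong[of \<phi> e e' \<Delta> \<omega>] by simp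
  then show ?thesis
    unfolding models_def using assms(2) by blast
qed

lemma models_Forall:
  fixes \<phi> :: "('p, 'c, 'v) fm"
  assumes "\<Delta> \<noteq> {}" "fv \<phi> \<subseteq> {x}"
  shows "models \<Delta> \<omega> (Forall x \<phi>) \<longleftrightarrow> (\<forall>a\<in>\<Delta>. models \<Delta> \<omega> (subst x a \<phi>))"
proof -
  \<comment> \<open>A nonempty domain supplies the assignment that \<open>models_closed\<close> asks
    for; a constant one suffices.\<close>
  obtain c where "c \<in> \<Delta>" using assms(1) by blast
  then have e: "(\<lambda>_ :: 'v. c) \<in> UNIV \<rightarrow> \<Delta>" by simp
  have "fv (Forall x \<phi>) = {}" "\<And>a. fv (subst x a \<phi>) = {}"
    using assms(2) by (auto simp: fv_subst)
  note closed = this[THEN models_closed, OF e]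
  show ?thesis
    by (simp only: closed sat_subst sat.simps)
qed

lemma models_Exists:
  fixes \<phi> :: "('p, 'c, 'v) fm"
  assumes "\<Delta> \<noteq> {}" "fv \<phi> \<subseteq> {x}"
  shows "models \<Delta> \<omega> (Exists x \<phi>) \<longleftrightarrow> (\<exists>a\<in>\<Delta>. models \<Delta> \<omega> (subst x a \<phi>))"
proof -
  obtain c where "c \<in> \<Delta>" using assms(1) by blast
  then have e: "(\<lambda>_ :: 'v. c) \<in> UNIV \<rightarrow> \<Delta>" by simp
  have "fv (Exists x \<phi>) = {}" "\<And>a. fv (subst x a \<phi>) = {}"
    using assms(2) by (auto simp: fv_subst)
  note closed = this[THEN models_closed, OF e]
  show ?thesis
    by (simp only: closed sat_subst sat.simps)
qed

lemma models_conj_list: "models \<Delta> \<omega> (conj_list \<phi>s) \<longleftrightarrow> (\<forall>\<phi>\<in>set \<phi>s. models \<Delta> \<omega> \<phi>)"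
proof (induction \<phi>s rule: conj_list.induct)
  case (3 \<phi> \<psi> \<phi>s)
  have "models \<Delta> \<omega> (Conj \<phi> \<chi>) \<longleftrightarrow> models \<Delta> \<omega> \<phi> \<and> models \<Delta> \<omega> \<chi>" for \<chi>
    by (simp add: models_def ball_conj_distrib)
  with 3 show ?case by simp
qed (simp_all add: models_def)

lemma fv_fol_of: "fv (fol_of (qs, \<phi>)) = fv \<phi> - set (map snd qs)"
proof (induction qs)
  case (Cons q qs)
  then show ?case by (cases q rule: prod.exhaust; cases "fst q") auto
qed simp

text \<open>If the prefix binds \<open>x\<close> again, \<open>qsubst\<close> keeps the matrix,
  while \<open>subst\<close> descends only to that binder and leaves its scope alone, so both sides
  agree.\<close>

lemma fol_of_qsubst: "fol_of (qsubst x a (qs, \<phi>)) = subst x a (fol_of (qs, \<phi>))"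
proof (induction qs)
  case (Cons q qs)
  then show ?case by (cases q rule: prod.exhaust; cases "fst q") auto
qed simp

text \<open>The gaps \<open>1 - f a\<close> are nonnegative, so they sum to zero only if each
  vanishes. This serves both the average over the domain and the sum over all sentences.\<close>

lemma sum_eq_card_iff:
  fixes f :: "'a \<Rightarrow> real"
  assumes "finite A" "\<And>a. a \<in> A \<Longrightarrow> f a \<le> 1"
  shows "sum f A = real (card A) \<longleftrightarrow> (\<forall>a\<in>A. f a = 1)"
proof -
  have "sum f A = real (card A) \<longleftrightarrow> (\<Sum>a\<in>A. 1 - f a) = 0"
    by (auto simp: sum_subtractf)
  also have "\<dots> \<longleftrightarrow> (\<forall>a\<in>A. f a = 1)"
    using assms by (subst sum_nonneg_eq_0_iff) auto
  finally show ?thesis .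
qed

text \<open>Bound and equality go through one induction on the prefix, since the equality step
  relies on the bound for the instances. The matrix is generalized because \<open>qsubst\<close>
  changes it.\<close>

lemma statistic_le_1_and_eq_1_iff:
  assumes "finite \<Delta>" "\<Delta> \<noteq> {}" "fv \<phi> \<subseteq> set (map snd qs)"
  shows "statistic \<Delta> \<omega> (qs, \<phi>) \<le> 1 \<and>
    (statistic \<Delta> \<omega> (qs, \<phi>) = 1 \<longleftrightarrow> models \<Delta> \<omega> (fol_of (qs, \<phi>)))"
  using assms(3)
proof (induction qs arbitrary: \<phi>)
  case (Cons q qs)
  obtain Q x where q: "q = (Q, x)" by (cases q)
  show ?case
  proof (cases "star_free ((Q, x) # qs, \<phi>)")
    \<comment> \<open>Only a prefix containing \<open>StarQ\<close> unfolds recursively; a star-free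
      one is evaluated by \<open>models\<close> at once.\<close>
    case False
    define f where "f a = statistic \<Delta> \<omega> (qsubst x a (qs, \<phi>))" for a
    have step: "statistic \<Delta> \<omega> ((Q, x) # qs, \<phi>) = (case Q of ForallQ \<Rightarrow> Min (f ` \<Delta>)
        | ExistsQ \<Rightarrow> Max (f ` \<Delta>) | StarQ \<Rightarrow> sum f \<Delta> / real (card \<Delta>))"
      using False unfolding f_def by (simp only: statistic.simps if_False)
    have f: "f a \<le> 1 \<and> (f a = 1 \<longleftrightarrow> models \<Delta> \<omega> (subst x a (fol_of (qs, \<phi>))))" for a
    proof -
      let ?\<psi> = "if x \<in> set (map snd qs) then \<phi> else subst x a \<phi>"
      have "fv ?\<psi> \<subseteq> set (map snd qs)"
        using Cons.prems by (auto simp: q fv_subst)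
      from Cons.IH[OF this] show ?thesis
        by (simp only: f_def qsubst.simps flip: fol_of_qsubst)
    qed
    have le: "\<And>a. f a \<le> 1" and eq: "\<And>a. models \<Delta> \<omega> (subst x a (fol_of (qs, \<phi>))) \<longleftrightarrow> f a = 1"
      using f by auto
    \<comment> \<open>As a lower bound, the condition passes through \<open>Min\<close> and
      \<open>Max\<close> by their order characterizations.\<close>
    have eq_1: "f a = 1 \<longleftrightarrow> 1 \<le> f a" for a
      using le[of a] by linarith
    have closed: "fv (fol_of (qs, \<phi>)) \<subseteq> {x}"
      using Cons.prems by (auto simp: q fv_fol_of)
    note models = models_Forall[OF assms(2) closed] models_Exists[OF assms(2) closed]
    have fin: "finite (f ` \<Delta>)" "f ` \<Delta> \<noteq> {}" using assms(1,2) by auto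
    show ?thesis
    proof (cases Q)
      case ForallQ
      have "Min (f ` \<Delta>) \<le> 1" using fin le assms(2) by (auto simp: Min_le_iff)
      moreover from this have "Min (f ` \<Delta>) = 1 \<longleftrightarrow> (\<forall>a\<in>\<Delta>. f a = 1)"
        using fin by (simp add: eq_1 order.eq_iff[of "Min (f ` \<Delta>)"])
      ultimately show ?thesis
        unfolding q step by (simp only: ForallQ quantifier.case fol_of.simps models eq simp_thms)
    next
      case ExistsQ
      have "Max (f ` \<Delta>) \<le> 1" using fin le by auto
      moreover from this have "Max (f ` \<Delta>) = 1 \<longleftrightarrow> (\<exists>a\<in>\<Delta>. f a = 1)"
        using fin by (simp add: Max_ge_iff eq_1 order.eq_iff[of "Max (f ` \<Delta>)"])
      ultimately show ?thesis
        unfolding q step by (simp only: ExistsQ quantifier.case fol_of.simps models eq simp_thms)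
    next
      case StarQ
      have "sum f \<Delta> \<le> real (card \<Delta>)" using sum_bounded_above[of \<Delta> f 1] le by simp
      then have "sum f \<Delta> / real (card \<Delta>) \<le> 1" by (simp add: divide_le_eq)
      moreover have "sum f \<Delta> / real (card \<Delta>) = 1 \<longleftrightarrow> (\<forall>a\<in>\<Delta>. f a = 1)"
        using sum_eq_card_iff[of \<Delta> f] assms(1,2) le by (simp add: eq_commute[of "real _"])
      ultimately show ?thesis
        unfolding q step by (simp only: StarQ quantifier.case fol_of.simps models eq simp_thms)
    qed
  qed (auto simp: q)
qed auto

lemma tendsto_exp_mult_at_top:
  fixes c :: real
  assumes "c \<le> 0"
  shows "((\<lambda>w. exp (w * c)) \<longlongrightarrow> (if c = 0 then 1 else 0)) at_top"
proof (cases "c = 0")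
  case False
  then have "filterlim (\<lambda>w. w * c) at_bot at_top"
    using assms filterlim_tendsto_neg_mult_at_bot[OF tendsto_const _ filterlim_ident, of c]
    by (simp add: mult.commute)
  then show ?thesis
    using False by (simp add: filterlim_compose[OF exp_at_bot])
qed simp

text \<open>Cancelling \<open>exp (w * m)\<close> makes every exponent \<open>w\<close> times a
  nonpositive number. Maximizers then contribute 1 and all other terms vanish in the limit; the
  denominator tends to the number of maximizers, which is nonzero because one exists.\<close>

lemma gibbs_tendsto_uniform:
  fixes S :: "'a \<Rightarrow> real"
  assumes "finite A" "\<And>y. y \<in> A \<Longrightarrow> S y \<le> m" "\<exists>y\<in>A. S y = m" "x \<in> A"
  shows "((\<lambda>w. exp (w * S x) / (\<Sum>y\<in>A. exp (w * S y))) \<longlongrightarrow>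
    (if S x = m then 1 / real (card {y \<in> A. S y = m}) else 0)) at_top"
proof -
  have lim: "((\<lambda>w. exp (w * (S y - m))) \<longlongrightarrow> (if S y = m then 1 else 0)) at_top"
    if "y \<in> A" for y
    using tendsto_exp_mult_at_top[of "S y - m"] assms(2)[OF that] by simp
  have card: "(\<Sum>y\<in>A. if S y = m then 1 else 0 :: real) = real (card {y \<in> A. S y = m})"
    using assms(1) by (simp add: sum.If_cases Int_def)
  have "((\<lambda>w. exp (w * (S x - m)) / (\<Sum>y\<in>A. exp (w * (S y - m)))) \<longlongrightarrow>
    (if S x = m then 1 else 0) / (\<Sum>y\<in>A. if S y = m then 1 else 0)) at_top"
    using assms by (intro tendsto_divide tendsto_sum lim) (auto simp: card)
  moreover have "exp (w * (S x - m)) / (\<Sum>y\<in>A. exp (w * (S y - m))) =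
      exp (w * S x) / (\<Sum>y\<in>A. exp (w * S y))" for w
    by (simp add: right_diff_distrib exp_diff flip: sum_divide_distrib)
  ultimately show ?thesis by (cases "S x = m") (simp_all add: card)
qed

lemma finite_worlds:
  assumes "finite \<sigma>" "finite \<Delta>"
  shows "finite (worlds \<sigma> ar \<Delta>)"
  unfolding worlds_def using assms by (intro finite_PiE) (auto intro: finite_lists_length_eq)

text \<open>Pairing with a fixed weight is injective. The sum runs over
  \<open>set \<alpha>s\<close>, so a repeated sentence counts once.\<close>

lemma unnormalized_uniform_qmln:
  "unnormalized \<Delta> (uniform_qmln \<alpha>s w) \<omega> = exp (w * (\<Sum>\<alpha>\<in>set \<alpha>s. statistic \<Delta> \<omega> \<alpha>))"
  unfolding unnormalized_def uniform_qmln_def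
  by (subst sum.reindex) (auto simp: inj_on_def sum_distrib_left)

theorem proposition5:
  fixes C \<Delta> :: "'c set" and \<sigma> :: "'p set" and ar :: "'p \<Rightarrow> nat"
    and \<alpha>s :: "('p, 'c, 'v) qsent list" and \<omega> :: "('p, 'c) world"
  assumes "finite C" and "finite \<sigma>"
    and "finite \<Delta>" and "\<Delta> \<noteq> {}" and "C \<subseteq> \<Delta>"
    and "\<And>w. is_qmln C \<sigma> ar (uniform_qmln \<alpha>s w)"
    and "\<exists>\<omega>' \<in> worlds \<sigma> ar \<Delta>. models \<Delta> \<omega>' (fol_hat \<alpha>s)"
    and "\<omega> \<in> worlds \<sigma> ar \<Delta>"
  shows "((\<lambda>w. qmln_prob \<sigma> ar \<Delta> (uniform_qmln \<alpha>s w) \<omega>) \<longlongrightarrow>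
           (if models \<Delta> \<omega> (fol_hat \<alpha>s)
            then 1 / real (card {\<omega>' \<in> worlds \<sigma> ar \<Delta>. models \<Delta> \<omega>' (fol_hat \<alpha>s)})
            else 0)) at_top"
proof -
  define S where "S \<omega> = (\<Sum>\<alpha>\<in>set \<alpha>s. statistic \<Delta> \<omega> \<alpha>)" for \<omega>
  have stat: "statistic \<Delta> \<omega> \<alpha> \<le> 1 \<and> (statistic \<Delta> \<omega> \<alpha> = 1 \<longleftrightarrow> models \<Delta> \<omega> (fol_of \<alpha>))"
    if "\<alpha> \<in> set \<alpha>s" for \<alpha> \<omega>
  proof -
    obtain qs \<phi> where \<alpha>: "\<alpha> = (qs, \<phi>)" by (cases \<alpha>)
    \<comment> \<open>Being a quantified sentence does not depend on the weight, so any weight may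
      be chosen, here 0.\<close>
    have "quantified_sentence C \<sigma> ar \<alpha>"
      using assms(6)[of 0] that by (auto simp: is_qmln_def uniform_qmln_def)
    then show ?thesis
      unfolding \<alpha> using assms(3,4) by (intro statistic_le_1_and_eq_1_iff) auto
  qed
  \<comment> \<open>The maximum for the Gibbs limit is the number of distinct sentences; the assumed
    model of \<open>fol_hat \<alpha>s\<close> attains it.\<close>
  have le: "S \<omega> \<le> real (card (set \<alpha>s))" for \<omega>
    unfolding S_def using sum_bounded_above[of "set \<alpha>s" "statistic \<Delta> \<omega>" 1] stat by simp
  have eq: "models \<Delta> \<omega> (fol_hat \<alpha>s) \<longleftrightarrow> S \<omega> = real (card (set \<alpha>s))" for \<omega>
    unfolding S_def using stat sum_eq_card_iff[of "set \<alpha>s" "statistic \<Delta> \<omega>"]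
    by (simp add: fol_hat_def models_conj_list)
  show ?thesis
    unfolding qmln_prob_def unnormalized_uniform_qmln eq S_def[symmetric]
    using assms(7,8) le
    by (intro gibbs_tendsto_uniform finite_worlds assms(2,3)) (auto simp: eq)
qed

end
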